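(* Let $1\le k<n$ and let $(V,\mathcal{H})$ be a $k$-hypergraph with $n=|V|$ vertices. Then $(V,\mathcal{H})$ is either separable or equatable, but not both.
   Context: A $k$-hypergraph is a pair $(V,\mathcal{H})$ with $V$ a finite set and $\mathcal{H}\subseteq\binom{V}{k}$ a set of $k$-element subsets of $V$ (the edges). Its complement is $\overline{\mathcal{H}}:=\binom{V}{k}\setminus\mathcal{H}$. Separable: there is a labeling $x:V\to\mathbb{R}$ such that, with $x(E):=\sum_{v\in E}x(v)$, $\mathcal{H}=\{E\subseteq V:|E|=k,\ x(E)\ge 0\}$. Equatable: there is a labeling $y:\binom{V}{k}\to\mathbb{R}_{\ge 0}$, not identically zero, such that for every $v\in V$, $\sum\{y(E):v\in E\in\mathcal{H}\}=\sum\{y(F):v\in F\in\overline{\mathcal{H}}\}$. *)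

theory Defs
  imports "HOL-Analysis.Analysis" "HOL-Library.Ramsey"
begin

definition hypergraph :: "nat \<Rightarrow> 'a set \<Rightarrow> 'a set set \<Rightarrow> bool" where
  "hypergraph k V H \<longleftrightarrow> finite V \<and> H \<subseteq> nsets V k"

definition hcomplement :: "nat \<Rightarrow> 'a set \<Rightarrow> 'a set set \<Rightarrow> 'a set set" where
  "hcomplement k V H = nsets V k - H"

(* A labeling of V (or of nsets V k) is a total function; only its values on V
   (or on nsets V k) matter. *)

definition separable :: "nat \<Rightarrow> 'a set \<Rightarrow> 'a set set \<Rightarrow> bool" where
  "separable k V H \<longleftrightarrow>
    (\<exists>x :: 'a \<Rightarrow> real. H = {E. E \<subseteq> V \<and> card E = k \<and> (\<Sum>v\<in>E. x v) \<ge> 0})"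

definition equatable :: "nat \<Rightarrow> 'a set \<Rightarrow> 'a set set \<Rightarrow> bool" where
  "equatable k V H \<longleftrightarrow>
    (\<exists>y :: 'a set \<Rightarrow> real.
      (\<forall>E \<in> nsets V k. y E \<ge> 0) \<and>
      (\<exists>E \<in> nsets V k. y E \<noteq> 0) \<and>
      (\<forall>v \<in> V. (\<Sum>E \<in> {E \<in> H. v \<in> E}. y E) = (\<Sum>F \<in> {F \<in> hcomplement k V H. v \<in> F}. y F)))"

end

theory Submission
  imports Defs
begin

text \<open>
  Attach to each \<open>k\<close>-set \<open>E\<close> its signed indicator vector \<open>a E\<close>, equal to \<open>1\<close> on \<open>E\<close> if
  \<open>E\<close> is an edge, to \<open>- 1\<close> on \<open>E\<close> if it is not, and to \<open>0\<close> off \<open>E\<close>. A labeling \<open>x\<close> with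
  positive inner product with every \<open>a E\<close> separates the hypergraph, and a nontrivial nonnegative
  linear dependence among the vectors \<open>a E\<close> is exactly a labeling that equates it. That one
  of the two exists is Gordan's theorem of the alternative, \<open>gordan_alternative\<close>: the point of
  the convex hull of the vectors that is closest to the origin is either the origin itself, and
  then its coefficients give the dependence, or a normal vector of a hyperplane that has all the
  vectors strictly on one side.

  The vertex set need not exhaust a finite type, so no Euclidean space has it as its
  coordinate set. The closest point is therefore found by minimizing the squared norm over the
  coefficients, which range over a simplex, compact in the product topology.

  Both alternatives cannot hold (\<open>not_separable_and_equatable\<close>): by double counting
  of incidences, a labeling \<open>y\<close> that balances at every vertex gives the sums of \<open>y E * x E\<close>
  over edges and over non-edges the same value. For a separating \<open>x\<close> the first sum
  is nonnegative and the second is nonpositive, so both vanish. As \<open>x\<close> is strictly negative on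
  non-edges, \<open>y\<close> vanishes there, and the balance at the vertices makes it vanish on
  the edges too.
\<close>

text \<open>
  First-order optimality: the slope at \<open>0\<close> is the limit of the difference quotients
  \<open>c + s * d\<close>.
\<close>

lemma quadratic_nonneg_imp_slope_nonneg:
  fixes c d :: real
  assumes "\<And>s. 0 < s \<Longrightarrow> s \<le> 1 \<Longrightarrow> 0 \<le> s * c + s\<^sup>2 * d"
  shows "0 \<le> c"
proof (rule tendsto_lowerbound)
  show "((\<lambda>s. c + s * d) \<longlongrightarrow> c) (at_right 0)"
    by (auto intro!: tendsto_eq_intros)
  have "0 \<le> c + s * d" if "0 < s" "s < 1" for s
  proof -
    have "0 \<le> s * (c + s * d)"
      using assms[of s] that by (simp add: algebra_simps power2_eq_square)
    with \<open>0 < s\<close> show ?thesis by (simp add: zero_le_mult_iff)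
  qed
  then show "\<forall>\<^sub>F s in at_right 0. 0 \<le> c + s * d"
    unfolding eventually_at_right_field by (intro exI[of _ 1]) auto
qed simp

text \<open>
  Fixing the coefficients outside \<open>I\<close> to \<open>0\<close> makes the simplex a closed subset of a product of
  compact sets indexed by the whole type, to which Tychonoff's theorem applies.
\<close>

lemma compact_simplex:
  fixes I :: "'i set"
  assumes "finite I"
  shows "compact {y :: 'i \<Rightarrow> real. (\<forall>i. i \<notin> I \<longrightarrow> y i = 0) \<and> (\<forall>i\<in>I. 0 \<le> y i) \<and> sum y I = 1}"
    (is "compact ?S")
proof -
  let ?X = "\<lambda>i. if i \<in> I then {0..1} else {0::real}"
  have "compact (Pi\<^sub>E UNIV ?X)"
  proof -
    have "compactin (product_topology (\<lambda>i. euclidean) UNIV) (Pi\<^sub>E UNIV ?X)"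
      by (subst compactin_PiE) auto
    then show ?thesis
      by (simp add: euclidean_product_topology)
  qed
  moreover have "closed {y :: 'i \<Rightarrow> real. sum y I = 1}"
    by (intro closed_Collect_eq continuous_on_sum continuous_on_product_coordinates continuous_on_const)
  ultimately have "compact (Pi\<^sub>E UNIV ?X \<inter> {y. sum y I = 1})"
    by (rule compact_Int_closed)
  moreover have "?S = Pi\<^sub>E UNIV ?X \<inter> {y. sum y I = 1}"
  proof (intro set_eqI iffI)
    fix y assume y: "y \<in> ?S"
    have "y i \<le> 1" if "i \<in> I" for i
      using member_le_sum[of i I y] y that assms by auto
    with y show "y \<in> Pi\<^sub>E UNIV ?X \<inter> {y. sum y I = 1}"
      by (auto simp: PiE_iff)
  next
    fix y assume "y \<in> Pi\<^sub>E UNIV ?X \<inter> {y. sum y I = 1}"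
    then show "y \<in> ?S"
      by (auto simp: PiE_iff split: if_splits)
  qed
  ultimately show ?thesis by simp
qed

text \<open>
  Gordan's theorem. Here \<open>p y\<close> is the combination of the vectors with coefficients \<open>y\<close>, and
  \<open>q y\<close> its squared norm. If \<open>y\<close> minimizes \<open>q\<close> over the simplex, then moving from \<open>p y\<close>
  towards any vector \<open>a j\<close> does not decrease the norm, so the inner product of \<open>p y\<close> and
  \<open>a j - p y\<close> is nonnegative, that is, the inner product of \<open>p y\<close> and \<open>a j\<close> is at least \<open>q y\<close>.
\<close>

lemma gordan_alternative:
  fixes a :: "'i \<Rightarrow> 'v \<Rightarrow> real"
  assumes "finite I" "finite V"
  shows "(\<exists>x. \<forall>i\<in>I. 0 < (\<Sum>v\<in>V. a i v * x v)) \<or>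
    (\<exists>y. (\<forall>i\<in>I. 0 \<le> y i) \<and> (\<exists>i\<in>I. y i \<noteq> 0) \<and> (\<forall>v\<in>V. (\<Sum>i\<in>I. y i * a i v) = 0))"
proof (cases "I = {}")
  case False
  define S where "S = {y :: 'i \<Rightarrow> real. (\<forall>i. i \<notin> I \<longrightarrow> y i = 0) \<and> (\<forall>i\<in>I. 0 \<le> y i) \<and> sum y I = 1}"
  define p where "p y v = (\<Sum>i\<in>I. y i * a i v)" for y v
  define q where "q y = (\<Sum>v\<in>V. (p y v)\<^sup>2)" for y
  obtain i0 where "i0 \<in> I" using \<open>I \<noteq> {}\<close> by blast
  then have "(\<lambda>i. if i = i0 then 1 else 0) \<in> S"
    using assms by (auto simp: S_def)
  then have "S \<noteq> {}" by blast
  moreover have "compact S"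
    unfolding S_def by (rule compact_simplex[OF assms(1)])
  moreover have "continuous_on S q"
    unfolding q_def p_def
    by (intro continuous_intros continuous_on_subset[OF continuous_on_product_coordinates]) auto
  ultimately obtain y where y: "y \<in> S" and min: "\<And>z. z \<in> S \<Longrightarrow> q y \<le> q z"
    using continuous_attains_inf[of S q] by blast
  show ?thesis
  proof (cases "q y = 0")
    case True
    have "sum y I \<noteq> 0"
      using y by (simp add: S_def)
    then have "\<exists>i\<in>I. y i \<noteq> 0"
      by (metis sum.neutral)
    moreover have "p y v = 0" if "v \<in> V" for v
      using sum_nonneg_eq_0_iff[OF assms(2), of "\<lambda>v. (p y v)\<^sup>2"] True that
      by (simp add: q_def)
    ultimately show ?thesis
      using y by (auto simp: S_def p_def)
  next
    case False
    have "0 \<le> q y"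
      by (auto simp: q_def intro: sum_nonneg)
    with False have pos: "0 < q y" by simp
    have "0 < (\<Sum>v\<in>V. a j v * p y v)" if j: "j \<in> I" for j
    proof -
      define d where "d v = a j v - p y v" for v
      have "0 \<le> s * (2 * (\<Sum>v\<in>V. p y v * d v)) + s\<^sup>2 * (\<Sum>v\<in>V. (d v)\<^sup>2)"
        if s: "0 < s" "s \<le> 1" for s
      proof -
        \<comment> \<open>the coefficients of the point a fraction \<open>s\<close> of the way from \<open>p y\<close> to \<open>a j\<close>\<close>
        define z where "z i = (1 - s) * y i + (if i = j then s else 0)" for i
        have "z \<in> S"
          using y s j assms
          by (auto simp: S_def z_def sum.distrib simp flip: sum_distrib_left)
        have p_z: "p z v = p y v + s * d v" for v
        proof -
          have "p z v = (\<Sum>i\<in>I. (1 - s) * (y i * a i v) + (if i = j then s * a i v else 0))"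
            unfolding p_def z_def by (intro sum.cong) (auto simp: algebra_simps)
          also have "\<dots> = (1 - s) * p y v + s * a j v"
            using j assms by (simp add: sum.distrib p_def flip: sum_distrib_left)
          finally show ?thesis by (simp add: d_def algebra_simps)
        qed
        have "q z = q y + (s * (2 * (\<Sum>v\<in>V. p y v * d v)) + s\<^sup>2 * (\<Sum>v\<in>V. (d v)\<^sup>2))"
          by (simp add: q_def p_z power2_sum power_mult_distrib sum.distrib sum_distrib_left
              algebra_simps)
        with min[OF \<open>z \<in> S\<close>] show ?thesis by linarith
      qed
      then have "0 \<le> 2 * (\<Sum>v\<in>V. p y v * d v)"
        by (rule quadratic_nonneg_imp_slope_nonneg)
      also have "(\<Sum>v\<in>V. p y v * d v) = (\<Sum>v\<in>V. a j v * p y v) - q y"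
        by (simp add: d_def q_def power2_eq_square algebra_simps sum_subtractf)
      finally have "q y \<le> (\<Sum>v\<in>V. a j v * p y v)" by simp
      with pos show ?thesis by (rule less_le_trans)
    qed
    then show ?thesis by blast
  qed
qed simp

text \<open>
  Double counting of the incident pairs \<open>v \<in> E\<close>, each with weight \<open>x v * y E\<close>.
\<close>

lemma sum_edge_weights_eq_sum_vertex_degrees:
  fixes x :: "'a \<Rightarrow> real" and y :: "'a set \<Rightarrow> real"
  assumes "finite V" "finite A" "A \<subseteq> Pow V"
  shows "(\<Sum>E\<in>A. y E * (\<Sum>v\<in>E. x v)) = (\<Sum>v\<in>V. x v * (\<Sum>E\<in>{E \<in> A. v \<in> E}. y E))"
proof -
  have "(\<Sum>E\<in>A. y E * (\<Sum>v\<in>E. x v)) = (\<Sum>E\<in>A. \<Sum>v\<in>{v \<in> V. v \<in> E}. y E * x v)"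
  proof (intro sum.cong refl)
    fix E assume "E \<in> A"
    then have "{v \<in> V. v \<in> E} = E" using assms by blast
    then show "y E * (\<Sum>v\<in>E. x v) = (\<Sum>v\<in>{v \<in> V. v \<in> E}. y E * x v)"
      by (simp add: sum_distrib_left)
  qed
  also have "\<dots> = (\<Sum>v\<in>V. \<Sum>E\<in>{E \<in> A. v \<in> E}. y E * x v)"
    using assms by (intro sum.swap_restrict) auto
  finally show ?thesis
    by (simp add: sum_distrib_left mult.commute)
qed

text \<open>
  The hypothesis \<open>1 \<le> k\<close> gives each edge a vertex at which to read off that its weight
  is \<open>0\<close>. For \<open>k = 0\<close> the claim fails: if \<open>H\<close> consists of the empty set alone, then
  the labeling \<open>y = 1\<close> balances trivially, while the empty sum \<open>0\<close> makes \<open>H\<close> separable.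
\<close>

lemma not_separable_and_equatable:
  assumes "1 \<le> k" and hyp: "hypergraph k V H"
    and "separable k V H"
  shows "\<not> equatable k V H"
proof
  assume "equatable k V H"
  then obtain y :: "'a set \<Rightarrow> real" where y0: "\<And>E. E \<in> nsets V k \<Longrightarrow> 0 \<le> y E"
    and y1: "\<exists>E \<in> nsets V k. y E \<noteq> 0"
    and bal: "\<And>v. v \<in> V \<Longrightarrow>
      (\<Sum>E\<in>{E \<in> H. v \<in> E}. y E) = (\<Sum>F\<in>{F \<in> hcomplement k V H. v \<in> F}. y F)"
    unfolding equatable_def by blast
  obtain x where x: "H = {E. E \<subseteq> V \<and> card E = k \<and> (\<Sum>v\<in>E. x v) \<ge> (0::real)}"
    using assms(3) unfolding separable_def by blast
  let ?C = "hcomplement k V H"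
  have V: "finite V" and H: "H \<subseteq> nsets V k"
    using hyp by (auto simp: hypergraph_def)
  have fin: "finite (nsets V k)" using V by (rule finite_imp_finite_nsets)
  have finH: "finite H" and finC: "finite ?C"
    using fin H by (auto simp: hcomplement_def intro: finite_subset)
  have sub: "nsets V k \<subseteq> Pow V" by (auto simp: nsets_def)
  have C: "?C \<subseteq> nsets V k" by (auto simp: hcomplement_def)
  have neg: "(\<Sum>v\<in>F. x v) < 0" if "F \<in> ?C" for F
    using that x by (auto simp: hcomplement_def nsets_def)
  have "(\<Sum>E\<in>H. y E * (\<Sum>v\<in>E. x v)) = (\<Sum>F\<in>?C. y F * (\<Sum>v\<in>F. x v))"
    using sum_edge_weights_eq_sum_vertex_degrees[OF V finH, of y x]
      sum_edge_weights_eq_sum_vertex_degrees[OF V finC, of y x] H C sub bal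
    by (simp add: subset_trans)
  moreover have "0 \<le> (\<Sum>E\<in>H. y E * (\<Sum>v\<in>E. x v))"
  proof (rule sum_nonneg)
    fix E assume "E \<in> H"
    moreover from this have "0 \<le> y E" using H y0 by blast
    ultimately show "0 \<le> y E * (\<Sum>v\<in>E. x v)" using x by auto
  qed
  ultimately have "0 \<le> (\<Sum>F\<in>?C. y F * (\<Sum>v\<in>F. x v))" by simp
  moreover have loss: "0 \<le> y F * - (\<Sum>v\<in>F. x v)" if "F \<in> ?C" for F
    using that neg[OF that] y0 C by (intro mult_nonneg_nonneg) auto
  then have "0 \<le> (\<Sum>F\<in>?C. y F * - (\<Sum>v\<in>F. x v))" by (rule sum_nonneg)
  ultimately have "(\<Sum>F\<in>?C. y F * - (\<Sum>v\<in>F. x v)) = 0" by (simp add: sum_negf)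
  then have yC: "y F = 0" if "F \<in> ?C" for F
    using sum_nonneg_eq_0_iff[OF finC loss] that neg[OF that] by force
  \<comment> \<open>the non-edges at a vertex weigh nothing, so by balance neither do the edges at it\<close>
  have yH: "y E = 0" if E: "E \<in> H" for E
  proof -
    obtain v where v: "v \<in> E"
      using E H \<open>1 \<le> k\<close> by (fastforce simp: nsets_def)
    then have "v \<in> V" using E H sub by blast
    then have "(\<Sum>E\<in>{E \<in> H. v \<in> E}. y E) = 0"
      using bal yC by simp
    moreover have "finite {E \<in> H. v \<in> E}" using finH by simp
    moreover have "0 \<le> y E'" if "E' \<in> {E \<in> H. v \<in> E}" for E'
      using that H y0 by blast
    ultimately have "\<forall>E'\<in>{E \<in> H. v \<in> E}. y E' = 0"
      by (metis (no_types, lifting) sum_nonneg_eq_0_iff)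
    with E v show ?thesis by blast
  qed
  show False
    using y1 yC yH by (auto simp: hcomplement_def)
qed

text \<open>
  Gordan's theorem for the signed indicator vectors. Its first alternative is a little stronger
  than separability, as it makes the label sums of edges strictly positive.
\<close>

lemma separable_or_equatable:
  assumes "hypergraph k V H"
  shows "separable k V H \<or> equatable k V H"
proof -
  have V: "finite V" and H: "H \<subseteq> nsets V k"
    using assms by (auto simp: hypergraph_def)
  have fin: "finite (nsets V k)" using V by (rule finite_imp_finite_nsets)
  define a :: "'a set \<Rightarrow> 'a \<Rightarrow> real"
    where "a E v = (if v \<in> E then if E \<in> H then 1 else - 1 else 0)" for E v
  from gordan_alternative[OF fin V, of a] show ?thesis
  proof (elim disjE exE conjE)
    fix x assume x: "\<forall>E\<in>nsets V k. 0 < (\<Sum>v\<in>V. a E v * x v)"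
    have "E \<in> H \<longleftrightarrow> 0 \<le> (\<Sum>v\<in>E. x v)" if E: "E \<in> nsets V k" for E
    proof -
      have "E \<subseteq> V" using E by (auto simp: nsets_def)
      then have "(\<Sum>v\<in>V. a E v * x v) = (\<Sum>v\<in>E. a E v * x v)"
        using V by (intro sum.mono_neutral_right) (auto simp: a_def)
      also have "\<dots> = (if E \<in> H then 1 else - 1) * (\<Sum>v\<in>E. x v)"
        by (simp add: a_def sum_negf)
      finally show ?thesis
        using x E by (auto split: if_splits)
    qed
    then have "H = {E. E \<subseteq> V \<and> card E = k \<and> (\<Sum>v\<in>E. x v) \<ge> 0}"
      using H V by (auto simp: nsets_def dest: finite_subset)
    then show ?thesis
      unfolding separable_def by blast
  next
    fix y assume y0: "\<forall>E\<in>nsets V k. 0 \<le> y E" and y1: "\<exists>E\<in>nsets V k. y E \<noteq> 0"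
      and dep: "\<forall>v\<in>V. (\<Sum>E\<in>nsets V k. y E * a E v) = 0"
    have "(\<Sum>E\<in>{E \<in> H. v \<in> E}. y E) = (\<Sum>F\<in>{F \<in> hcomplement k V H. v \<in> F}. y F)"
      if "v \<in> V" for v
    proof -
      have "(\<Sum>E\<in>nsets V k. y E * a E v)
          = (\<Sum>E\<in>hcomplement k V H. y E * a E v) + (\<Sum>E\<in>H. y E * a E v)"
        unfolding hcomplement_def using fin H by (rule sum.subset_diff[rotated])
      also have "(\<Sum>E\<in>H. y E * a E v) = (\<Sum>E\<in>{E \<in> H. v \<in> E}. y E)"
        using finite_subset[OF H fin] by (simp add: sum.inter_filter a_def if_distrib cong: if_cong)
      also have "(\<Sum>E\<in>hcomplement k V H. y E * a E v)
          = (\<Sum>E\<in>hcomplement k V H. if v \<in> E then - y E else 0)"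
        by (intro sum.cong) (auto simp: a_def hcomplement_def)
      also have "\<dots> = - (\<Sum>F\<in>{F \<in> hcomplement k V H. v \<in> F}. y F)"
        using fin by (simp add: hcomplement_def flip: sum.inter_filter sum_negf)
      finally show ?thesis using dep that by simp
    qed
    then show ?thesis
      using y0 y1 unfolding equatable_def by blast
  qed
qed

theorem lemma2p1:
  fixes k n :: nat and V :: "'a set" and H :: "'a set set"
  assumes "1 \<le> k" and "k < n"
    and "hypergraph k V H" and "n = card V"
  shows "(separable k V H \<or> equatable k V H) \<and> \<not> (separable k V H \<and> equatable k V H)"
  using separable_or_equatable[OF assms(3)] not_separable_and_equatable[OF assms(1,3)] by blast

end
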